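(* Let $\mathcal{E}(\rho)=W\rho W^{\dagger}$ be an isometric encoding channel from $L$ to $S$, with $W:\mathcal{H}_L\to\mathcal{H}_S$ and $W^{\dagger}W=\mathbf{1}_L$, and let $\mathcal{N}(\sigma)=\sum_{i=1}^{n}A_i\sigma A_i^{\dagger}$ with $\sum_{i=1}^n A_i^{\dagger}A_i=\mathbf{1}_S$ be a noise channel on $S$. Let $\mathbf{G}$ be a Lie group with Lie algebra of dimension $d_{\mathbf{G}}$ and unitary representations $U_L$ on $\mathcal{H}_L$ and $U_S$ on $\mathcal{H}_S$, and let $\{H_L^p\otimes\mathbf{1}_S+\mathbf{1}_L\otimes H_S^p:p=1,\dots,d_{\mathbf{G}}\}$ be an orthonormal base of the Lie algebra as represented on $\mathcal{H}_L\otimes\mathcal{H}_S$ via the unitary representation $\{U_L^*(g)\otimes U_S(g)\}_{g\in\mathbf{G}}$. Then the infidelity $\epsilon(\mathcal{N}\circ\mathcal{E})$ and the noncovariance $N_{\mathbf{G}}(\mathcal{E})$ satisfy $$\frac{4\epsilon^2(\mathcal{N}\circ\mathcal{E})}{n}+N_{\mathbf{G}}(\mathcal{E})\geq\frac{1}{n^2+d_{\mathbf{G}}}\,I\left(|\tilde\psi\rangle\langle\tilde\psi|,K\right),$$ where $$K=\sum_{i,j=1}^{n}\mathbf{1}_L\otimes K_{ij}+\sum_{p=1}^{d_{\mathbf{G}}}\left(H_L^p\otimes\mathbf{1}_S+\mathbf{1}_L\otimes H_S^p\right),\qquad K_{ij}=PA_i^{\dagger}A_jP,\quad P=WW^{\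dagger}.$$
   Context: All Hilbert spaces are finite-dimensional, $d_L=\dim\mathcal{H}_L$. $R$ is a reference system identical to $L$, $|\psi\rangle_{LR}=\frac{1}{\sqrt{d_L}}\sum_{k=1}^{d_L}|k\rangle_L|k\rangle_R$, and $|\tilde\psi\rangle_{LS}=(\mathbf{1}_L\otimes W_{R\to S})|\psi\rangle_{LR}$, so that the Choi state of $\mathcal{E}$ is $\Phi_{\mathcal{E}}=(\mathcal{I}_L\otimes\mathcal{E}_{R\to S})(|\psi\rangle\langle\psi|_{LR})=|\tilde\psi\rangle\langle\tilde\psi|_{LS}$. Generalized Wigner-Yanase skew information: for a state $\rho$ and an arbitrary (possibly non-Hermitian) operator $X$, $I(\rho,X)=\frac12\mathrm{tr}\left([\sqrt\rho,X][\sqrt\rho,X]^{\dagger}\right)=\frac12\|[\sqrt\rho,X]\|_2^2$, with $[A,B]=AB-BA$ and $\|\cdot\|_2$ the Hilbert-Schmidt norm. Infidelity (with the single encoding Kraus operator $W$): $$\epsilon^2(\mathcal{N}\circ\mathcal{E})=\frac{n}{4d_L}\sum_{i,j=1}^{n}\left(\mathrm{tr}(PA_j^{\dagger}A_iPA_i^{\dagger}A_j)-\frac{1}{d_L}|\mathrm{tr}(PA_i^{\dagger}A_j)|^2\right).$$ Generators are taken to be Hermitian operators. Here $U_L^*(g)$ is the entrywise complex conjugate of $U_L(g)$; if $\pi_L$ and $\pi_S$ are the representations of the Lie algebra associated with $\{U_L^*(g)\}$ and $\{U_S(g)\}$, the Lie algebra is represented on $\mathcal{H}_L\otimes\mathcal{H}_S$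 by $X\mapsto\pi_L(X)\otimes\mathbf{1}_S+\mathbf{1}_L\otimes\pi_S(X)$, and $H_L^p,H_S^p$ are the images under $\pi_L,\pi_S$ of the $p$-th base element. Noncovariance of $\mathcal{E}$ with respect to $\mathbf{G}$: $N_{\mathbf{G}}(\mathcal{E})=\sum_{p=1}^{d_{\mathbf{G}}}I\left(\Phi_{\mathcal{E}},H_L^p\otimes\mathbf{1}_S+\mathbf{1}_L\otimes H_S^p\right)$. *)

theory Defs
  imports "HOL-Analysis.Analysis" "HOL-Algebra.Group"
begin

section \<open>Matrices, tensor products and states\<close>

text \<open>
  A linear map from \<open>\<complex>\<^sup>n\<close> to \<open>\<complex>\<^sup>m\<close> is a matrix of type \<open>complex ^ 'n ^ 'm\<close>, and the tensor
  product of the spaces indexed by \<open>'m\<close> and \<open>'n\<close> is the space indexed by \<open>'m \<times> 'n\<close>.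
\<close>

definition dagger :: "complex ^ 'n ^ 'm \<Rightarrow> complex ^ 'm ^ 'n" where
  "dagger A = (\<chi> i j. cnj (A $ j $ i))"

definition kron :: "complex ^ 'n ^ 'm \<Rightarrow> complex ^ 'q ^ 'p \<Rightarrow> complex ^ ('n \<times> 'q) ^ ('m \<times> 'p)"
    (infixr "\<otimes>\<^sub>k" 71) where
  "A \<otimes>\<^sub>k B = (\<chi> i j. A $ fst i $ fst j * B $ snd i $ snd j)"

definition kron_vec :: "complex ^ 'm \<Rightarrow> complex ^ 'n \<Rightarrow> complex ^ ('m \<times> 'n)" where
  "kron_vec u v = (\<chi> i. u $ fst i * v $ snd i)"

definition ketbra :: "complex ^ 'n \<Rightarrow> complex ^ 'n ^ 'n" where
  "ketbra v = (\<chi> i j. v $ i * cnj (v $ j))"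

definition psd :: "complex ^ 'n ^ 'n \<Rightarrow> bool" where
  "psd A \<longleftrightarrow> dagger A = A \<and> (\<forall>v. 0 \<le> Re (\<Sum>i\<in>UNIV. cnj (v $ i) * (A *v v) $ i))"

definition psd_sqrt :: "complex ^ 'n ^ 'n \<Rightarrow> complex ^ 'n ^ 'n" where
  "psd_sqrt \<rho> = (THE B. psd B \<and> B ** B = \<rho>)"

definition commutator :: "complex ^ 'n ^ 'n \<Rightarrow> complex ^ 'n ^ 'n \<Rightarrow> complex ^ 'n ^ 'n" where
  "commutator A B = A ** B - B ** A"

text \<open>The trace below is real and nonnegative, so taking its real part loses nothing.\<close>

definition skew_information :: "complex ^ 'n ^ 'n \<Rightarrow> complex ^ 'n ^ 'n \<Rightarrow> real" where
  "skew_information \<rho> X =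
     Re (trace (commutator (psd_sqrt \<rho>) X ** dagger (commutator (psd_sqrt \<rho>) X))) / 2"

section \<open>Encodings, noise and infidelity\<close>

text \<open>The reference system \<open>R\<close> is identical to \<open>L\<close>, so both carry the index type \<open>'l\<close>.\<close>

definition max_entangled :: "complex ^ ('l::finite \<times> 'l)" where
  "max_entangled =
     complex_of_real (1 / sqrt (real CARD('l))) *s (\<Sum>k\<in>UNIV. kron_vec (axis k 1) (axis k 1))"

definition encoded_max_entangled :: "complex ^ 'l ^ 's \<Rightarrow> complex ^ ('l \<times> 's)" where
  "encoded_max_entangled W = (mat 1 \<otimes>\<^sub>k W) *v max_entangled"

definition encoding_channel :: "complex ^ 'l ^ 's \<Rightarrow> complex ^ 'l ^ 'l \<Rightarrow> complex ^ 's ^ 's" where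
  "encoding_channel W \<rho> = W ** \<rho> ** dagger W"

text \<open>\<open>id_tensor \<E>\<close> applies \<open>\<E>\<close> to each block \<open>M\<^sub>a\<^sub>b\<close> of \<open>M = \<Sum>\<^sub>a\<^sub>b |a\<rangle>\<langle>b| \<otimes> M\<^sub>a\<^sub>b\<close>.\<close>

definition id_tensor :: "(complex ^ 'r ^ 'r \<Rightarrow> complex ^ 's ^ 's) \<Rightarrow>
    complex ^ ('l::finite \<times> 'r) ^ ('l \<times> 'r) \<Rightarrow> complex ^ ('l \<times> 's) ^ ('l \<times> 's)" where
  "id_tensor \<E> M =
     (\<chi> i j. \<E> (\<chi> r q. M $ (fst i, r) $ (fst j, q)) $ snd i $ snd j)"

definition choi_state ::
    "(complex ^ 'l ^ 'l \<Rightarrow> complex ^ 's ^ 's) \<Rightarrow> complex ^ ('l \<times> 's) ^ ('l \<times> 's)" where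
  "choi_state \<E> = id_tensor \<E> (ketbra max_entangled)"

definition code_projector :: "complex ^ 'l ^ 's \<Rightarrow> complex ^ 's ^ 's" where
  "code_projector W = W ** dagger W"

text \<open>
  The infidelity is expressed through the Kraus operators \<open>A\<^sub>1, \<dots>, A\<^sub>n\<close> of the noise and the
  single Kraus operator \<open>W\<close> of the encoding. Both the individual traces
  \<open>tr (P A\<^sub>j\<^sup>\<dagger> A\<^sub>i P A\<^sub>i\<^sup>\<dagger> A\<^sub>j)\<close> and the radicand are real and nonnegative.
\<close>

definition infidelity ::
    "complex ^ 'l ^ 's \<Rightarrow> nat \<Rightarrow> (nat \<Rightarrow> complex ^ 's ^ 's) \<Rightarrow> real" where
  "infidelity W n A =
     (let P = code_projector W; d = real CARD('l) in
      sqrt (real n / (4 * d) *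
        (\<Sum>i=1..n. \<Sum>j=1..n.
           Re (trace (P ** dagger (A j) ** A i ** P ** dagger (A i) ** A j))
           - (cmod (trace (P ** dagger (A i) ** A j)))\<^sup>2 / d)))"

section \<open>Lie groups and their unitary representations\<close>

fun differentiable_order_on ::
    "'a::real_normed_vector set \<Rightarrow> ('a \<Rightarrow> 'b::real_normed_vector) \<Rightarrow> nat \<Rightarrow> bool" where
  "differentiable_order_on S f 0 \<longleftrightarrow> continuous_on S f"
| "differentiable_order_on S f (Suc k) \<longleftrightarrow>
     (\<forall>x\<in>S. f differentiable (at x)) \<and>
     (\<forall>v. differentiable_order_on S (\<lambda>x. frechet_derivative f (at x) v) k)"

text \<open>Only used for open \<open>S\<close> in a finite-dimensional space, where it is \<open>C\<^sup>\<infinity>\<close>-smoothness.\<close>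

definition smooth_on ::
    "'a::real_normed_vector set \<Rightarrow> ('a \<Rightarrow> 'b::real_normed_vector) \<Rightarrow> bool" where
  "smooth_on S f \<longleftrightarrow> (\<forall>k. differentiable_order_on S f k)"

text \<open>A chart is its domain together with the coordinate map.\<close>

type_synonym ('g, 'e) chart = "'g set \<times> ('g \<Rightarrow> 'e)"

abbreviation chart_inv :: "('g, 'e) chart \<Rightarrow> 'e \<Rightarrow> 'g" where
  "chart_inv c \<equiv> inv_into (fst c) (snd c)"

text \<open>
  The model space is any finite-dimensional normed space rather than one of class
  \<open>euclidean_space\<close>, which would exclude Lie groups of dimension 0.
\<close>

locale lie_group = group G for G :: "('g, 'm) monoid_scheme" (structure) +
  fixes T :: "'g topology"
    and \<A> :: "('g, 'e::real_normed_vector) chart set"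
  assumes finite_dim: "\<exists>B :: 'e set. finite B \<and> span B = UNIV"
    and topspace: "topspace T = carrier G"
    and Hausdorff: "Hausdorff_space T"
    and second_countable: "second_countable T"
    and charts_cover: "(\<Union>c\<in>\<A>. fst c) = carrier G"
    and chart_domain: "c \<in> \<A> \<Longrightarrow> openin T (fst c)"
    and chart_range: "c \<in> \<A> \<Longrightarrow> open (snd c ` fst c)"
    and chart_homeomorphic: "c \<in> \<A> \<Longrightarrow>
      homeomorphic_map (subtopology T (fst c)) (top_of_set (snd c ` fst c)) (snd c)"
    and chart_transition: "c \<in> \<A> \<Longrightarrow> c' \<in> \<A> \<Longrightarrow>
      smooth_on (snd c ` (fst c \<inter> fst c')) (snd c' \<circ> chart_inv c)"
    and mult_continuous: "continuous_map (prod_topology T T) T (\<lambda>(x, y). x \<otimes> y)"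
    and inv_continuous: "continuous_map T T (\<lambda>x. inv x)"
    and mult_smooth: "a \<in> \<A> \<Longrightarrow> b \<in> \<A> \<Longrightarrow> c \<in> \<A> \<Longrightarrow>
      smooth_on {(x, y). x \<in> snd a ` fst a \<and> y \<in> snd b ` fst b \<and>
                         chart_inv a x \<otimes> chart_inv b y \<in> fst c}
        (\<lambda>(x, y). snd c (chart_inv a x \<otimes> chart_inv b y))"
    and inv_smooth: "a \<in> \<A> \<Longrightarrow> c \<in> \<A> \<Longrightarrow>
      smooth_on {x. x \<in> snd a ` fst a \<and> inv (chart_inv a x) \<in> fst c}
        (\<lambda>x. snd c (inv (chart_inv a x)))"

text \<open>
  Finite-dimensional representations are only required to be continuous; continuous
  homomorphisms of Lie groups are automatically smooth.
\<close>

definition unitary_rep ::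
    "('g, 'm) monoid_scheme \<Rightarrow> 'g topology \<Rightarrow> ('g \<Rightarrow> complex ^ 'n ^ 'n) \<Rightarrow> bool" where
  "unitary_rep G T U \<longleftrightarrow>
     (\<forall>g\<in>carrier G. dagger (U g) ** U g = mat 1 \<and> U g ** dagger (U g) = mat 1) \<and>
     (\<forall>g\<in>carrier G. \<forall>h\<in>carrier G. U (g \<otimes>\<^bsub>G\<^esub> h) = U g ** U h) \<and>
     continuous_map T euclidean U"

text \<open>
  The chart \<open>c\<close> around the identity identifies the Lie algebra, i.e. the tangent space at the
  identity, with the model space: \<open>v\<close> is the velocity at \<open>0\<close> of the curve with coordinates
  \<open>snd c \<one> + t v\<close>. The factor \<open>-\<i>\<close> makes the generators of unitary representations Hermitian.
\<close>

definition generator :: "('g, 'm) monoid_scheme \<Rightarrow> ('g, 'e::real_normed_vector) chart \<Rightarrow>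
    ('g \<Rightarrow> complex ^ 'n ^ 'n) \<Rightarrow> 'e \<Rightarrow> complex ^ 'n ^ 'n" where
  "generator G c U v =
     map_matrix ((*) (- \<i>))
       (vector_derivative (\<lambda>t. U (chart_inv c (snd c \<one>\<^bsub>G\<^esub> + t *\<^sub>R v))) (at 0))"

definition vector_space_base :: "nat \<Rightarrow> (nat \<Rightarrow> 'e::real_vector) \<Rightarrow> bool" where
  "vector_space_base d X \<longleftrightarrow>
     inj_on X {1..d} \<and> independent (X ` {1..d}) \<and> span (X ` {1..d}) = UNIV"

text \<open>Orthonormality is with respect to the Hilbert-Schmidt inner product; the span is real.\<close>

definition orthonormal_base ::
    "nat \<Rightarrow> (nat \<Rightarrow> complex ^ 'n ^ 'n) \<Rightarrow> (complex ^ 'n ^ 'n) set \<Rightarrow> bool" where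
  "orthonormal_base d H V \<longleftrightarrow>
     (\<forall>p\<in>{1..d}. \<forall>q\<in>{1..d}. trace (dagger (H p) ** H q) = (if p = q then 1 else 0)) \<and>
     span (H ` {1..d}) = V"

definition joint_generator ::
    "complex ^ 'l ^ 'l \<Rightarrow> complex ^ 's ^ 's \<Rightarrow> complex ^ ('l \<times> 's) ^ ('l \<times> 's)" where
  "joint_generator HL HS = HL \<otimes>\<^sub>k mat 1 + mat 1 \<otimes>\<^sub>k HS"

definition noncovariance :: "nat \<Rightarrow> (nat \<Rightarrow> complex ^ 'l ^ 'l) \<Rightarrow> (nat \<Rightarrow> complex ^ 's ^ 's) \<Rightarrow>
    (complex ^ 'l ^ 'l \<Rightarrow> complex ^ 's ^ 's) \<Rightarrow> real" where
  "noncovariance d HL HS \<E> =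
     (\<Sum>p=1..d. skew_information (choi_state \<E>) (joint_generator (HL p) (HS p)))"

end

theory Submission
  imports Defs
begin

text \<open>
  The skew information is half the squared Hilbert-Schmidt norm of \<open>[\<surd>\<rho>, X]\<close>, which is linear in
  \<open>X\<close>; by Cauchy-Schwarz, the skew information of a sum of \<open>m\<close> operators is at most \<open>m\<close> times the
  sum of their skew informations. Apply this to the \<open>n\<^sup>2 + d\<close> summands of \<open>K\<close>. The Choi state is the
  pure state of the encoded maximally entangled vector, so the generators contribute the
  noncovariance. On a pure state
  \<open>I(X) = (\<langle>X X\<^sup>\<dagger>\<rangle> + \<langle>X\<^sup>\<dagger> X\<rangle>) / 2 - |\<langle>X\<rangle>|\<^sup>2\<close>, and with \<open>\<langle>1 \<otimes> Y\<rangle> = tr (P Y) / d\<^sub>L\<close> the terms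
  \<open>1 \<otimes> K\<^sub>i\<^sub>j\<close> contribute exactly \<open>4 \<epsilon>\<^sup>2 / n\<close>.
\<close>

section \<open>Algebra of adjoints and tensor products\<close>

lemma dagger_dagger: "dagger (dagger A) = A"
  by (simp add: dagger_def vec_eq_iff)

lemma dagger_mult: "dagger (A ** B) = dagger B ** dagger A"
  by (simp add: dagger_def vec_eq_iff matrix_matrix_mult_def mult.commute)

lemma dagger_diff: "dagger (A - B) = dagger A - dagger B"
  by (simp add: dagger_def vec_eq_iff)

lemma dagger_kron: "dagger (A \<otimes>\<^sub>k B) = dagger A \<otimes>\<^sub>k dagger B"
  by (simp add: dagger_def kron_def vec_eq_iff)

lemma dagger_mat_1: "dagger (mat 1) = mat 1"
  by (simp add: dagger_def mat_def vec_eq_iff)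

lemma dagger_ketbra: "dagger (ketbra v) = ketbra v"
  by (simp add: dagger_def ketbra_def vec_eq_iff mult.commute)

lemma sum_prod_UNIV: "(\<Sum>x\<in>UNIV. f x) = (\<Sum>a\<in>UNIV. \<Sum>b\<in>UNIV. f (a, b))"
  by (simp add: sum.cartesian_product flip: UNIV_Times_UNIV)

lemma kron_mult: "(A \<otimes>\<^sub>k B) ** (C \<otimes>\<^sub>k D) = (A ** C) \<otimes>\<^sub>k (B ** D)"
  by (simp add: kron_def vec_eq_iff matrix_matrix_mult_def sum_prod_UNIV sum_product mult_ac)

section \<open>Skew information as a Hilbert-Schmidt norm\<close>

text \<open>The norm of a vector of row vectors is the Euclidean norm over all entries, so the
  built-in \<open>norm\<close> is already the Hilbert-Schmidt norm and its triangle inequality can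
  be used directly.\<close>

lemma trace_mult_dagger: "trace (M ** dagger M) = of_real ((norm M)\<^sup>2)"
proof -
  have "(norm M)\<^sup>2 = (\<Sum>i\<in>UNIV. \<Sum>j\<in>UNIV. (cmod (M $ i $ j))\<^sup>2)"
    by (simp add: norm_vec_def L2_set_def sum_nonneg)
  then show ?thesis
    by (simp add: trace_def matrix_matrix_mult_def dagger_def flip: complex_norm_square)
qed

lemma skew_information_eq_norm:
  "skew_information \<rho> X = (norm (commutator (psd_sqrt \<rho>) X))\<^sup>2 / 2"
  by (simp add: skew_information_def trace_mult_dagger)

lemma skew_information_nonneg: "0 \<le> skew_information \<rho> X"
  by (simp add: skew_information_eq_norm)

lemma matrix_diff_ldistrib: "A ** (B - C) = A ** B - A ** (C :: complex ^ _ ^ _)"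
  by (simp add: vec_eq_iff matrix_matrix_mult_def right_diff_distrib sum_subtractf)

lemma matrix_diff_rdistrib: "(B - C) ** A = B ** A - (C :: complex ^ _ ^ _) ** A"
  by (simp add: vec_eq_iff matrix_matrix_mult_def left_diff_distrib sum_subtractf)

lemma commutator_add: "commutator S (X + Y) = commutator S X + commutator S Y"
  by (simp add: commutator_def vec_eq_iff matrix_matrix_mult_def ring_distribs sum.distrib)

lemma commutator_sum: "finite I \<Longrightarrow> commutator S (\<Sum>k\<in>I. F k) = (\<Sum>k\<in>I. commutator S (F k))"
  by (induction I rule: finite_induct) (simp_all add: commutator_add, simp add: commutator_def)

lemma skew_information_sum_le:
  assumes "finite I"
  shows "skew_information \<rho> (\<Sum>k\<in>I. F k) \<le> real (card I) * (\<Sum>k\<in>I. skew_information \<rho> (F k))"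
proof -
  let ?c = "\<lambda>k. norm (commutator (psd_sqrt \<rho>) (F k))"
  have "(norm (\<Sum>k\<in>I. commutator (psd_sqrt \<rho>) (F k)))\<^sup>2 \<le> (\<Sum>k\<in>I. ?c k)\<^sup>2"
    by (intro power_mono norm_sum) simp
  also have "\<dots> \<le> real (card I) * (\<Sum>k\<in>I. (?c k)\<^sup>2)"
    using sum_squared_le_sum_of_squares[of ?c I] by (cases "finite I") (simp_all add: mult.commute)
  finally show ?thesis
    using assms by (simp add: skew_information_eq_norm commutator_sum sum_distrib_left flip: sum_divide_distrib)
qed

section \<open>Expectation values and rank-one operators\<close>

text \<open>The quadratic form appearing in \<open>psd\<close>, so positivity reads as
  \<open>0 \<le> Re (expval v A)\<close> for all \<open>v\<close>.\<close>

definition expval :: "complex ^ 'n \<Rightarrow> complex ^ 'n ^ 'n \<Rightarrow> complex" where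
  "expval v M = (\<Sum>i\<in>UNIV. cnj (v $ i) * (M *v v) $ i)"

lemma expval_double_sum: "expval v M = (\<Sum>i\<in>UNIV. \<Sum>j\<in>UNIV. cnj (v $ i) * M $ i $ j * v $ j)"
  by (simp add: expval_def matrix_vector_mult_def sum_distrib_left mult.assoc)

lemma trace_ketbra_mult: "trace (ketbra v ** M) = expval v M"
  unfolding expval_double_sum
  by (subst sum.swap) (simp add: trace_def matrix_matrix_mult_def ketbra_def mult_ac)

lemma expval_dagger: "expval v (dagger M) = cnj (expval v M)"
  unfolding expval_double_sum
  by (subst sum.swap) (simp add: dagger_def mult_ac)

lemma expval_mat_1: "expval v (mat 1) = of_real ((norm v)\<^sup>2)"
  by (simp add: expval_def norm_vec_def L2_set_def sum_nonneg mult.commute[of "cnj _"] flip: complex_norm_square)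

lemma ketbra_mult_ketbra:
  "ketbra v ** M ** ketbra v = map_matrix ((*) (expval v M)) (ketbra v)"
proof -
  have "(ketbra v ** M ** ketbra v) $ a $ b = expval v M * (v $ a * cnj (v $ b))" for a b
    unfolding expval_double_sum
    by (simp add: matrix_matrix_mult_def ketbra_def sum_distrib_left sum_distrib_right, subst sum.swap)
      (simp add: mult_ac)
  then show ?thesis
    by (simp add: vec_eq_iff map_matrix_def ketbra_def)
qed

lemma ketbra_idem: "norm v = 1 \<Longrightarrow> ketbra v ** ketbra v = ketbra v"
  using ketbra_mult_ketbra[of v "mat 1"]
  by (simp add: expval_mat_1 vec_eq_iff map_matrix_def)

text \<open>A rank-one operator in the middle splits the product into two scalars. This is the
  source of the squared mean in the pure-state skew information.\<close>

lemma expval_ketbra_sandwich: "expval v (M ** ketbra v ** N) = expval v M * expval v N"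
proof -
  have "expval v (M ** ketbra v ** N) = trace (ketbra v ** M ** ketbra v ** N)"
    by (simp add: matrix_mul_assoc flip: trace_ketbra_mult)
  also have "\<dots> = trace (map_matrix ((*) (expval v M)) (ketbra v) ** N)"
    by (simp only: ketbra_mult_ketbra)
  also have "\<dots> = expval v M * trace (ketbra v ** N)"
    by (simp add: trace_def matrix_matrix_mult_def map_matrix_def sum_distrib_left mult.assoc)
  finally show ?thesis
    by (simp add: trace_ketbra_mult)
qed

text \<open>One factor \<open>B\<close> moves to the left side of the inner product. Hence a
  vanishing expectation of \<open>B ** B\<close> forces \<open>B *v v = 0\<close>.\<close>

lemma expval_sq_eq_norm:
  assumes "dagger B = B"
  shows "expval v (B ** B) = of_real ((norm (B *v v))\<^sup>2)"
proof -
  have "(\<Sum>i\<in>UNIV. cnj (v $ i) * (dagger B *v u) $ i) = (\<Sum>k\<in>UNIV. cnj ((B *v v) $ k) * u $ k)" for u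
    unfolding matrix_vector_mult_def
    by (simp add: dagger_def sum_distrib_left sum_distrib_right, subst sum.swap) (simp add: mult_ac)
  then have "expval v (dagger B ** B) = (\<Sum>k\<in>UNIV. cnj ((B *v v) $ k) * (B *v v) $ k)"
    unfolding expval_def matrix_vector_mul_assoc[symmetric] .
  then show ?thesis
    using assms by (simp add: norm_vec_def L2_set_def sum_nonneg mult.commute[of "cnj _"] flip: complex_norm_square)
qed

lemma psd_ketbra: "psd (ketbra v)"
proof -
  have "expval u (ketbra v) = of_real ((cmod (\<Sum>i\<in>UNIV. cnj (u $ i) * v $ i))\<^sup>2)" for u
    unfolding complex_norm_square expval_double_sum cnj_sum sum_product
    by (simp add: ketbra_def mult_ac)
  then show ?thesis
    by (simp add: psd_def dagger_ketbra flip: expval_def)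
qed

text \<open>Existence is idempotence. For uniqueness, any positive root is a multiple
  \<open>?c\<close> of the projector; squaring gives \<open>?c * ?c = 1\<close>, and
  \<open>?c\<close> is real and nonnegative.\<close>

lemma psd_sqrt_ketbra:
  assumes v: "norm v = 1"
  shows "psd_sqrt (ketbra v) = ketbra v"
  unfolding psd_sqrt_def
proof (rule the_equality)
  show "psd (ketbra v) \<and> ketbra v ** ketbra v = ketbra v"
    by (simp add: psd_ketbra ketbra_idem v)
next
  fix B assume "psd B \<and> B ** B = ketbra v"
  then have herm: "dagger B = B" and pos: "0 \<le> Re (expval v B)" and sq: "B ** B = ketbra v"
    by (auto simp: psd_def expval_def)
  \<comment> \<open>\<open>B\<close> is supported on \<open>v\<close> because \<open>\<parallel>B u\<parallel>\<^sup>2 = \<langle>u, B\<^sup>2 u\<rangle> = 0\<close> for \<open>u\<close> orthogonal to \<open>v\<close>.\<close>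
  have B_kills: "B *v (u - ketbra v *v u) = 0" for u
  proof -
    have "B ** B *v (u - ketbra v *v u) = 0"
      by (simp add: sq matrix_vector_mult_diff_distrib matrix_vector_mul_assoc ketbra_idem v)
    then have "expval (u - ketbra v *v u) (B ** B) = 0"
      by (simp add: expval_def)
    then show ?thesis
      by (simp add: expval_sq_eq_norm herm)
  qed
  \<comment> \<open>Every \<open>u\<close> is its projection onto \<open>v\<close> plus a remainder
    killed by \<open>B\<close>.\<close>
  have right: "B ** ketbra v = B"
    using B_kills by (simp add: matrix_eq matrix_vector_mult_diff_distrib flip: matrix_vector_mul_assoc)
  have left: "ketbra v ** B = B"
    using arg_cong[OF right, of dagger] by (simp add: dagger_mult dagger_ketbra herm)
  let ?c = "expval v B"
  have B: "B = map_matrix ((*) ?c) (ketbra v)"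
    using ketbra_mult_ketbra[of v B] by (simp add: left right)
  have "expval v (ketbra v) = 1"
    using expval_ketbra_sandwich[of v "mat 1" "mat 1"] by (simp add: expval_mat_1 v)
  \<comment> \<open>Absorbing the middle projector leaves \<open>B ** B\<close>, which is the
    projector itself.\<close>
  moreover have "expval v (ketbra v) = ?c * ?c"
  proof -
    have "expval v (B ** ketbra v ** B) = ?c * ?c" by (rule expval_ketbra_sandwich)
    then show ?thesis by (simp add: right sq)
  qed
  moreover have "?c \<in> \<real>"
    using expval_dagger[of v B] by (simp add: herm Reals_cnj_iff)
  ultimately have "?c = 1"
    using pos by (metis Re_complex_of_real complex_is_Real_iff mult_minus_left square_eq_1_iff one_complex.simps(1) uminus_complex.simps(1) neg_0_le_iff_le not_one_le_zero)
  then show "B = ketbra v"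
    using B by (simp add: vec_eq_iff map_matrix_def)
qed

text \<open>The root of the state is the state itself, so the squared commutator expands into four
  traces. By cyclicity two become the means of \<open>X ** dagger X\<close> and
  \<open>dagger X ** X\<close>, which may differ for non-Hermitian \<open>X\<close>; the other two
  have a projector between \<open>X\<close> and its adjoint and factor into the squared
  mean.\<close>

lemma skew_information_ketbra:
  assumes v: "norm v = 1"
  shows "skew_information (ketbra v) X =
    (Re (expval v (X ** dagger X)) + Re (expval v (dagger X ** X))) / 2 - (cmod (expval v X))\<^sup>2"
proof -
  let ?R = "ketbra v"
  let ?Y = "dagger X"
  have "trace (commutator ?R X ** dagger (commutator ?R X))
      = trace (?R ** (X ** ?Y ** ?R)) - trace (?R ** (X ** ?R ** ?Y))
        - (trace (X ** (?R ** ?Y ** ?R)) - trace (X ** ?R ** (?R ** ?Y)))"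
    by (simp add: commutator_def dagger_diff dagger_mult dagger_ketbra matrix_diff_ldistrib
        matrix_diff_rdistrib trace_sub matrix_mul_assoc)
  also have "trace (X ** ?R ** (?R ** ?Y)) = expval v (?Y ** X)"
    by (metis trace_ketbra_mult trace_mul_sym matrix_mul_assoc ketbra_idem v)
  also have "trace (?R ** (X ** ?Y ** ?R)) = expval v (X ** ?Y)"
    by (metis trace_ketbra_mult trace_mul_sym matrix_mul_assoc ketbra_idem v)
  also have "trace (X ** (?R ** ?Y ** ?R)) = expval v (?Y ** ?R ** X)"
    by (metis trace_ketbra_mult trace_mul_sym matrix_mul_assoc)
  finally show ?thesis
    by (simp add: skew_information_def psd_sqrt_ketbra v trace_ketbra_mult expval_ketbra_sandwich
        expval_dagger mult.commute[of "cnj _"] flip: complex_norm_square)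
qed

section \<open>The encoded maximally entangled state\<close>

lemma max_entangled_nth:
  "(max_entangled :: complex ^ ('l::finite \<times> 'l)) $ (a, b) =
     (if a = b then of_real (1 / sqrt (real CARD('l))) else 0)"
proof -
  have "(\<Sum>k\<in>UNIV. axis k 1 $ a * axis k 1 $ b :: complex) = (\<Sum>k\<in>UNIV. if k = a then of_bool (a = b) else 0)"
    by (intro sum.cong) (auto simp: axis_def)
  then show ?thesis
    by (simp add: max_entangled_def kron_vec_def)
qed

lemma encoded_max_entangled_nth:
  "encoded_max_entangled (W :: complex ^ 'l ^ 's) $ (a, s) = of_real (1 / sqrt (real CARD('l))) * W $ s $ a"
proof -
  let ?c = "complex_of_real (1 / sqrt (real CARD('l)))"
  have "encoded_max_entangled W $ (a, s)
      = (\<Sum>b\<in>UNIV. \<Sum>r\<in>UNIV. (if a = b then 1 else 0) * W $ s $ r * (if b = r then ?c else 0))"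
    by (simp only: encoded_max_entangled_def matrix_vector_mult_def vec_lambda_beta sum_prod_UNIV
        kron_def mat_def max_entangled_nth fst_conv snd_conv)
  \<comment> \<open>Products of Kronecker deltas become nested conditionals, the form in which delta
    sums collapse.\<close>
  also have "\<dots> = (\<Sum>b\<in>UNIV. if b = a then \<Sum>r\<in>UNIV. if r = a then ?c * W $ s $ a else 0 else 0)"
    by (intro sum.cong refl) (auto simp del: sum.delta sum.delta' intro!: sum.cong)
  finally show ?thesis
    by simp
qed

text \<open>Ties noncovariance to the same pure state in which the infidelity is evaluated
  below.\<close>

lemma choi_state_encoding_channel:
  fixes W :: "complex ^ 'l ^ 's"
  shows "choi_state (encoding_channel W) = ketbra (encoded_max_entangled W)"
proof -
  let ?c = "complex_of_real (1 / sqrt (real CARD('l)))"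
  have "choi_state (encoding_channel W) $ (a, s) $ (b, t) = ?c * W $ s $ a * cnj (?c * W $ t $ b)" for a b s t
  proof -
    have "choi_state (encoding_channel W) $ (a, s) $ (b, t)
        = (\<Sum>q\<in>UNIV. (\<Sum>r\<in>UNIV. W $ s $ r *
            ((if a = r then ?c else 0) * cnj (if b = q then ?c else 0))) * cnj (W $ t $ q))"
      by (simp only: choi_state_def id_tensor_def encoding_channel_def ketbra_def dagger_def
          matrix_matrix_mult_def vec_lambda_beta max_entangled_nth fst_conv snd_conv)
    also have "\<dots> = (\<Sum>q\<in>UNIV. if q = b
        then \<Sum>r\<in>UNIV. if r = a then ?c * W $ s $ a * cnj (?c * W $ t $ b) else 0 else 0)"
      unfolding sum_distrib_right
      by (intro sum.cong refl) (auto simp: mult_ac simp del: sum.delta sum.delta' intro!: sum.cong)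
    finally show ?thesis
      by simp
  qed
  then show ?thesis
    by (simp add: vec_eq_iff ketbra_def encoded_max_entangled_nth)
qed

text \<open>The reduced state on the physical system is the code projector divided by the logical
  dimension.\<close>

lemma expval_encoded_max_entangled:
  fixes W :: "complex ^ 'l ^ 's"
  shows "expval (encoded_max_entangled W) (mat 1 \<otimes>\<^sub>k Y) = trace (code_projector W ** Y) / of_nat CARD('l)"
proof -
  define c where "c = complex_of_real (1 / sqrt (real CARD('l)))"
  have c: "cnj c * c = 1 / of_nat CARD('l)"
    unfolding c_def complex_cnj_complex_of_real of_real_mult[symmetric] by simp
  have v: "encoded_max_entangled W $ (a, s) = c * W $ s $ a" for a s
    by (simp add: encoded_max_entangled_nth c_def)
  \<comment> \<open>The vector is a rescaled vectorisation of \<open>W\<close>, so acting on the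
    second factor vectorises \<open>Y ** W\<close>.\<close>
  have apply_Y: "((mat 1 \<otimes>\<^sub>k Y) *v encoded_max_entangled W) $ (a, s) = c * (Y ** W) $ s $ a" for a s
  proof -
    have "((mat 1 \<otimes>\<^sub>k Y) *v encoded_max_entangled W) $ (a, s)
        = (\<Sum>b\<in>UNIV. if b = a then \<Sum>t\<in>UNIV. Y $ s $ t * (c * W $ t $ b) else 0)"
      by (simp only: matrix_vector_mult_def vec_lambda_beta sum_prod_UNIV kron_def mat_def v fst_conv snd_conv)
        (intro sum.cong refl, simp)
    then show ?thesis
      by (simp add: matrix_matrix_mult_def sum_distrib_left mult_ac)
  qed
  have "expval (encoded_max_entangled W) (mat 1 \<otimes>\<^sub>k Y) = cnj c * c * trace (dagger W ** (Y ** W))"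
  proof -
    have "trace (dagger W ** Z) = (\<Sum>a\<in>UNIV. \<Sum>s\<in>UNIV. cnj (W $ s $ a) * Z $ s $ a)" for Z :: "complex ^ 'l ^ 's"
      by (simp add: trace_def matrix_matrix_mult_def dagger_def)
    then show ?thesis
      unfolding expval_def sum_prod_UNIV apply_Y v by (simp add: sum_distrib_left mult_ac)
  qed
  also have "trace (dagger W ** (Y ** W)) = trace (code_projector W ** Y)"
    unfolding code_projector_def by (metis trace_mul_sym matrix_mul_assoc)
  finally show ?thesis
    by (simp add: c)
qed

lemma norm_encoded_max_entangled:
  fixes W :: "complex ^ 'l ^ 's"
  assumes "dagger W ** W = mat 1"
  shows "norm (encoded_max_entangled W) = 1"
proof -
  have kron_1: "(mat 1 \<otimes>\<^sub>k mat 1 :: complex ^ ('l \<times> 's) ^ ('l \<times> 's)) = mat 1"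
    by (auto simp: vec_eq_iff kron_def mat_def prod_eq_iff)
  have "of_real ((norm (encoded_max_entangled W))\<^sup>2) = expval (encoded_max_entangled W) (mat 1)"
    by (rule expval_mat_1[symmetric])
  also have "\<dots> = trace (W ** dagger W) / of_nat CARD('l)"
    using expval_encoded_max_entangled[of W "mat 1"] by (simp add: kron_1 code_projector_def)
  also have "\<dots> = 1"
    by (subst trace_mul_sym) (simp add: assms trace_I)
  finally have "(norm (encoded_max_entangled W))\<^sup>2 = 1"
    by (metis of_real_eq_1_iff)
  then show ?thesis
    using norm_ge_zero[of "encoded_max_entangled W"] by (auto simp: power2_eq_1_iff)
qed

section \<open>Infidelity as a sum of skew informations\<close>

lemma infidelity_sq:
  fixes W :: "complex ^ 'l ^ 's"
  assumes iso: "dagger W ** W = mat 1"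
  shows "(infidelity W n A)\<^sup>2 = real n / 4 *
    (\<Sum>i=1..n. \<Sum>j=1..n. skew_information (ketbra (encoded_max_entangled W))
       (mat 1 \<otimes>\<^sub>k (code_projector W ** dagger (A i) ** A j ** code_projector W)))"
proof -
  let ?v = "encoded_max_entangled W"
  define P where "P = code_projector W"
  define d where "d = real CARD('l)"
  define K where "K i j = P ** dagger (A i) ** A j ** P" for i j
  define a where "a i j = Re (trace (P ** dagger (A j) ** A i ** P ** dagger (A i) ** A j))" for i j
  define b where "b i j = (cmod (trace (P ** dagger (A i) ** A j)))\<^sup>2" for i j
  have d: "d > 0" by (simp add: d_def)
  have PP: "P ** P = P"
    by (metis P_def code_projector_def iso matrix_mul_assoc matrix_mul_lid)
  have dP: "dagger P = P"
    by (simp add: P_def code_projector_def dagger_mult dagger_dagger)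
  have dK: "dagger (K i j) = K j i" for i j
    by (simp add: K_def dagger_mult dagger_dagger dP matrix_mul_assoc)
  have KK: "Re (expval ?v (mat 1 \<otimes>\<^sub>k (K j i ** K i j))) = a i j / d" for i j
  proof -
    \<comment> \<open>Adjacent copies of \<open>P\<close> are kept until cyclicity has brought the
      last one to the front; then idempotence merges them.\<close>
    have "trace (P ** (K j i ** K i j)) = trace (P ** P ** dagger (A j) ** A i ** (P ** P) ** dagger (A i) ** A j ** P)"
      by (simp add: K_def matrix_mul_assoc)
    also have "\<dots> = trace (P ** (P ** P ** dagger (A j) ** A i ** (P ** P) ** dagger (A i) ** A j))"
      by (rule trace_mul_sym)
    also have "\<dots> = trace ((P ** P ** P) ** dagger (A j) ** A i ** (P ** P) ** dagger (A i) ** A j)"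
      by (simp add: matrix_mul_assoc)
    finally show ?thesis
      by (simp add: expval_encoded_max_entangled a_def d_def PP flip: P_def)
  qed
  have K1: "(cmod (expval ?v (mat 1 \<otimes>\<^sub>k K i j)))\<^sup>2 = b i j / d\<^sup>2" for i j
  proof -
    have "trace (P ** K i j) = trace ((P ** P) ** dagger (A i) ** A j ** P)"
      by (simp add: K_def matrix_mul_assoc)
    also have "\<dots> = trace (P ** ((P ** P) ** dagger (A i) ** A j))"
      by (rule trace_mul_sym)
    also have "\<dots> = trace ((P ** P ** P) ** dagger (A i) ** A j)"
      by (simp add: matrix_mul_assoc)
    finally show ?thesis
      by (simp add: expval_encoded_max_entangled b_def d_def PP norm_divide power_divide flip: P_def)
  qed
  \<comment> \<open>Since the adjoint exchanges the indices, the two orderings of the product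
    contribute \<open>a j i\<close> and \<open>a i j\<close>.\<close>
  have I: "skew_information (ketbra ?v) (mat 1 \<otimes>\<^sub>k K i j) = (a j i + a i j) / (2 * d) - b i j / d\<^sup>2" for i j
    by (simp add: skew_information_ketbra norm_encoded_max_entangled[OF iso] dagger_kron dagger_mat_1
        kron_mult dK KK K1 add_divide_distrib)
  \<comment> \<open>Only after summation over all pairs do the two halves agree and cancel the
    factor 1/2.\<close>
  have "(\<Sum>i=1..n. \<Sum>j=1..n. a j i) = (\<Sum>i=1..n. \<Sum>j=1..n. a i j)"
    by (rule sum.swap)
  then have S: "(\<Sum>i=1..n. \<Sum>j=1..n. skew_information (ketbra ?v) (mat 1 \<otimes>\<^sub>k K i j)) = (\<Sum>i=1..n. \<Sum>j=1..n. a i j - b i j / d) / d"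
    using d by (simp add: I sum_subtractf sum.distrib power2_eq_square add_divide_distrib diff_divide_distrib
      flip: sum_divide_distrib)
  have "real n / (4 * d) * (\<Sum>i=1..n. \<Sum>j=1..n. a i j - b i j / d) =
      real n / 4 * (\<Sum>i=1..n. \<Sum>j=1..n. skew_information (ketbra ?v) (mat 1 \<otimes>\<^sub>k K i j))"
    unfolding S by simp
  \<comment> \<open>The radicand must be nonnegative for the square to undo
    \<open>sqrt\<close>.\<close>
  moreover have "\<dots> \<ge> 0"
    by (intro mult_nonneg_nonneg sum_nonneg skew_information_nonneg) simp
  ultimately show ?thesis
    unfolding infidelity_def Let_def
    by (simp only: a_def b_def K_def P_def d_def real_sqrt_pow2)
qed

theorem mainTheorem2:
  fixes W :: "complex ^ 'l ^ 's"
    and n :: nat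
    and A :: "nat \<Rightarrow> complex ^ 's ^ 's"
    and G :: "('g, 'm) monoid_scheme"
    and T :: "'g topology"
    and \<A> :: "('g, 'e::real_normed_vector) chart set"
    and c :: "('g, 'e) chart"
    and d :: nat
    and X :: "nat \<Rightarrow> 'e"
    and UL :: "'g \<Rightarrow> complex ^ 'l ^ 'l"
    and US :: "'g \<Rightarrow> complex ^ 's ^ 's"
    and HL :: "nat \<Rightarrow> complex ^ 'l ^ 'l"
    and HS :: "nat \<Rightarrow> complex ^ 's ^ 's"
  assumes isometry: "dagger W ** W = mat 1"
    and kraus: "(\<Sum>i=1..n. dagger (A i) ** A i) = mat 1"
    and lie_group: "lie_group G T \<A>"
    and chart: "c \<in> \<A>" "\<one>\<^bsub>G\<^esub> \<in> fst c"
    and dim: "d = dim (UNIV :: 'e set)"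
    and rep_L: "unitary_rep G T UL"
    and rep_S: "unitary_rep G T US"
    and base: "vector_space_base d X"
    and HL: "\<forall>p\<in>{1..d}. HL p = generator G c (\<lambda>g. map_matrix cnj (UL g)) (X p)"
    and HS: "\<forall>p\<in>{1..d}. HS p = generator G c US (X p)"
    and orthonormal: "orthonormal_base d (\<lambda>p. joint_generator (HL p) (HS p))
      (range (generator G c (\<lambda>g. map_matrix cnj (UL g) \<otimes>\<^sub>k US g)))"
  shows "let P = code_projector W;
             K = (\<Sum>i=1..n. \<Sum>j=1..n. mat 1 \<otimes>\<^sub>k (P ** dagger (A i) ** A j ** P))
                 + (\<Sum>p=1..d. joint_generator (HL p) (HS p))
         in 4 * (infidelity W n A)\<^sup>2 / real n + noncovariance d HL HS (encoding_channel W)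
            \<ge> 1 / (real n ^ 2 + real d) * skew_information (ketbra (encoded_max_entangled W)) K"
proof -
  let ?\<rho> = "ketbra (encoded_max_entangled W)"
  define F where "F i j = (mat 1 :: complex ^ 'l ^ 'l) \<otimes>\<^sub>k (code_projector W ** dagger (A i) ** A j ** code_projector W)" for i j
  define J where "J p = joint_generator (HL p) (HS p)" for p
  define S where "S = (\<Sum>i=1..n. \<Sum>j=1..n. skew_information ?\<rho> (F i j)) + (\<Sum>p=1..d. skew_information ?\<rho> (J p))"
  \<comment> \<open>A disjoint union indexes all summands of \<open>K\<close> at once; its
    cardinality \<open>n * n + d\<close> is the constant of the bound.\<close>
  let ?I = "({1..n} \<times> {1..n}) <+> {1..d}"
  let ?f = "case_sum (\<lambda>(i, j). F i j) J"
  \<comment> \<open>An empty Kraus sum would be zero instead of the identity. This permits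
    cancelling \<open>n\<close> and dividing by \<open>n^2 + d\<close>.\<close>
  have "n \<noteq> 0"
  proof
    assume "n = 0"
    then show False
      using kraus by (simp add: vec_eq_iff mat_def) (metis zero_neq_one)
  qed
  have "skew_information ?\<rho> (\<Sum>x\<in>?I. ?f x) \<le> real (card ?I) * (\<Sum>x\<in>?I. skew_information ?\<rho> (?f x))"
    by (rule skew_information_sum_le) simp
  then have main: "skew_information ?\<rho> ((\<Sum>i=1..n. \<Sum>j=1..n. F i j) + (\<Sum>p=1..d. J p)) \<le> (real n ^ 2 + real d) * S"
    by (simp add: S_def sum.Plus card_Plus sum.cartesian_product power2_eq_square case_prod_unfold comp_def)
  have "4 * (infidelity W n A)\<^sup>2 / real n + noncovariance d HL HS (encoding_channel W) = S"
    using \<open>n \<noteq> 0\<close>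
    by (simp add: infidelity_sq[OF isometry] S_def F_def J_def noncovariance_def choi_state_encoding_channel)
  moreover have "0 < real n ^ 2 + real d"
    using \<open>n \<noteq> 0\<close> by (simp add: add_pos_nonneg)
  ultimately show ?thesis
    using main by (simp add: Let_def F_def J_def field_simps)
qed

end
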